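(* Let $0\le k<n<N$ be integers and let $x_0\in\mathbb{R}_+^N$ be a fixed vector with exactly $k$ nonzero entries. Let $A$ be a random $n\times N$ matrix with exchangeable columns whose nullspace $\mathcal{N}(A)$ is an orthant-symmetric and generic random subspace. Then $$\mathrm{Prob}\{\mathcal{N}(A)\cap\mathrm{Feas}_{x_0}(\mathbb{R}_+^N)=\{0\}\}=1-P_{N-n,N-k},$$ where, for positive integers $m,M$, $$P_{m,M}=2^{-M+1}\sum_{\ell=0}^{m-1}\binom{M-1}{\ell}.$$
   Context: $\mathbb{R}_+^N=\{x\in\mathbb{R}^N: x_i\ge 0\ \forall i\}$. For a polyhedral set $P\subset\mathbb{R}^N$ and $x_0\in P$, $\mathrm{Feas}_{x_0}(P)$ is the set of feasible directions: all $v$ with $x_0+tv\in P$ for all sufficiently small $t>0$. $A$ has exchangeable columns if $\mathrm{Prob}\{A\in\Omega\}=\mathrm{Prob}\{A\Pi\in\Omega\}$ for every permutation matrix $\Pi$ and measurable set $\Omega$. A random $(N-n)\times N$ matrix $B$ is orthant-symmetric if for each diagonal matrix $S$ with diagonal in $\{-1,1\}^N$ and every measurable set $\Omega$, $\mathrm{Prob}\{BS\in\Omega\}=\mathrm{Prob}\{B\in\Omega\}$. Let $V_B$ be the linear span of the rows of $B$. If $B$ is orthant-symmetric, $V_B$ is called an orthant-symmetric random subspace. If every subset of $N-n$ columns of $B$ is almost surely linearly independent, $V_B$ is called a generic random subspace. A random $n\times N$ matrix $A$ has an orthant-symmetric and generic nullspace if its nullspace $\mathcal{N}(A)$ equals $V_B$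 for a random matrix $B$ having both properties. *)

theory Defs
  imports "HOL-Probability.Probability"
begin

text \<open>
  An \<open>r \<times> N\<close> real matrix has type \<open>real ^ 'N ^ 'r\<close> with \<open>CARD('r) = r\<close> and
  \<open>CARD('N) = N\<close>; a random matrix is a Borel measurable map from a probability space \<open>M\<close>
  to this type.
\<close>

definition nonneg_orthant :: "(real ^ 'N) set" where
  "nonneg_orthant = {x. \<forall>i. 0 \<le> x $ i}"

definition Feas :: "'a::real_normed_vector \<Rightarrow> 'a set \<Rightarrow> 'a set" where
  "Feas x0 P = {v. \<exists>\<epsilon>>0. \<forall>t. 0 < t \<and> t < \<epsilon> \<longrightarrow> x0 + t *\<^sub>R v \<in> P}"

definition nullspace :: "real ^ 'N ^ 'r \<Rightarrow> (real ^ 'N) set" where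
  "nullspace A = {v. A *v v = 0}"

definition row_span :: "real ^ 'N ^ 'r \<Rightarrow> (real ^ 'N) set" where
  "row_span B = span (rows B)"

definition permutation_matrix :: "real ^ 'N ^ 'N \<Rightarrow> bool" where
  "permutation_matrix Q \<longleftrightarrow>
     (\<exists>p. p permutes UNIV \<and> Q = (\<chi> i j. if i = p j then 1 else 0))"

definition sign_matrix :: "real ^ 'N ^ 'N \<Rightarrow> bool" where
  "sign_matrix S \<longleftrightarrow>
     (\<forall>i j. i \<noteq> j \<longrightarrow> S $ i $ j = 0) \<and> (\<forall>i. S $ i $ i \<in> {-1, 1})"

definition exchangeable_columns :: "'a measure \<Rightarrow> ('a \<Rightarrow> real ^ 'N ^ 'r) \<Rightarrow> bool" where
  "exchangeable_columns M A \<longleftrightarrow>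
     (\<forall>Q. permutation_matrix Q \<longrightarrow>
       (\<forall>\<Omega>\<in>sets borel. \<P>(\<omega> in M. A \<omega> \<in> \<Omega>) = \<P>(\<omega> in M. A \<omega> ** Q \<in> \<Omega>)))"

definition orthant_symmetric :: "'a measure \<Rightarrow> ('a \<Rightarrow> real ^ 'N ^ 'r) \<Rightarrow> bool" where
  "orthant_symmetric M B \<longleftrightarrow>
     (\<forall>S. sign_matrix S \<longrightarrow>
       (\<forall>\<Omega>\<in>sets borel. \<P>(\<omega> in M. B \<omega> ** S \<in> \<Omega>) = \<P>(\<omega> in M. B \<omega> \<in> \<Omega>)))"

text \<open>
  Linear independence below is that of the family of columns indexed by \<open>J\<close>. As
  \<^const>\<open>independent\<close> is a predicate on sets of vectors, injectivity is required
  separately, to exclude repeated columns.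
\<close>

definition generic_columns :: "'a measure \<Rightarrow> ('a \<Rightarrow> real ^ 'N ^ 'r) \<Rightarrow> bool" where
  "generic_columns M B \<longleftrightarrow>
     (\<forall>J::'N set. card J = CARD('r) \<longrightarrow>
       (AE \<omega> in M. inj_on (\<lambda>j. column j (B \<omega>)) J \<and> independent ((\<lambda>j. column j (B \<omega>)) ` J)))"

text \<open>
  The type argument gives the row index type \<open>'m\<close> of the matrix \<open>B\<close> whose rows
  span the nullspace; for an \<open>n \<times> N\<close> matrix \<open>A\<close> it is to be used with \<open>CARD('m) = N - n\<close>.
  Equality of the two random subspaces is almost sure equality.
\<close>

definition orthant_symmetric_generic_nullspace ::
    "'m::finite itself \<Rightarrow> 'a measure \<Rightarrow> ('a \<Rightarrow> real ^ 'N ^ 'n) \<Rightarrow> bool" where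
  "orthant_symmetric_generic_nullspace _ M A \<longleftrightarrow>
     (\<exists>B :: 'a \<Rightarrow> real ^ 'N ^ 'm.
        B \<in> borel_measurable M \<and> orthant_symmetric M B \<and> generic_columns M B \<and>
        (AE \<omega> in M. nullspace (A \<omega>) = row_span (B \<omega>)))"

definition P_coeff :: "nat \<Rightarrow> nat \<Rightarrow> real" where
  "P_coeff m M = 2 powi (- int M + 1) * (\<Sum>l = 0..m - 1. real ((M - 1) choose l))"

end

theory Submission
  imports Defs
begin

text \<open>
  Let \<open>I\<close> be the zero set of \<open>x0\<close> and \<open>b\<^sub>i\<close> the columns of \<open>B\<close>. The feasible cone is
  \<open>{v. \<forall>i\<in>I. 0 \<le> v\<^sub>i}\<close>, so by genericity the row span of \<open>B\<close> meets it nontrivially iff some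
  \<open>y\<close> satisfies \<open>b\<^sub>i \<bullet> y > 0\<close> for all \<open>i \<in> I\<close>. By orthant symmetry, all \<open>2 ^ card I\<close> sign
  patterns of \<open>(b\<^sub>i \<bullet> y)\<^sub>i\<close> are equally likely to be realised by some \<open>y\<close>, and by Cover's count
  the number of realised patterns is almost surely a constant; this is Wendel's theorem.
\<close>

section \<open>Sign patterns of finitely many linear functionals\<close>

text \<open>Continuity at \<open>0\<close>, for finitely many conditions at once. The non-strict
  bound on \<open>t\<close> allows later proofs to take \<open>t = e\<close> and
  \<open>t = - e\<close> themselves.\<close>

lemma finite_positive_perturbation:
  fixes f g :: "'i \<Rightarrow> real"
  assumes "finite I" "\<And>j. j \<in> I \<Longrightarrow> 0 < f j"
  obtains e where "e > 0" "\<And>t j. \<lbrakk>\<bar>t\<bar> \<le> e; j \<in> I\<rbrakk> \<Longrightarrow> 0 < f j + t * g j"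
proof -
  have "\<forall>\<^sub>F t in nhds 0. 0 < f j + t * g j" if "j \<in> I" for j
  proof (rule order_tendstoD)
    have "((\<lambda>t. f j + t * g j) \<longlongrightarrow> f j + 0 * g j) (nhds 0)"
      by (intro tendsto_intros filterlim_ident)
    then show "((\<lambda>t. f j + t * g j) \<longlongrightarrow> f j) (nhds 0)" by simp
  qed (use assms(2) that in auto)
  then have "\<forall>\<^sub>F t in nhds 0. \<forall>j\<in>I. 0 < f j + t * g j"
    by (intro eventually_ball_finite assms(1)) auto
  then obtain d where "d > 0" "\<And>t. dist t 0 < d \<Longrightarrow> \<forall>j\<in>I. 0 < f j + t * g j"
    unfolding eventually_nhds_metric by blast
  then show thesis
    by (intro that[of "d / 2"]) auto
qed

definition sign_of :: "'i set \<Rightarrow> 'i \<Rightarrow> real" where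
  "sign_of T i = (if i \<in> T then 1 else - 1)"

text \<open>A pattern is coded by its set \<open>T\<close> of positive indices. As all inequalities
  are strict, patterns correspond to the open regions into which the sets
  \<open>b i \<bullet> y = 0\<close> cut \<open>W\<close>.\<close>

definition sign_patterns :: "'v::euclidean_space set \<Rightarrow> ('i \<Rightarrow> 'v) \<Rightarrow> 'i set \<Rightarrow> 'i set set" where
  "sign_patterns W b I = {T. T \<subseteq> I \<and> (\<exists>y\<in>W. \<forall>i\<in>I. 0 < sign_of T i * (b i \<bullet> y))}"

text \<open>
  General position is stated through dimensions of annihilators (with truncated subtraction) because
  this form passes to the hyperplane sections of \<open>W\<close> used in the induction.
\<close>

definition general_position :: "'v::euclidean_space set \<Rightarrow> ('i \<Rightarrow> 'v) \<Rightarrow> 'i set \<Rightarrow> bool" where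
  "general_position W b I \<longleftrightarrow>
     (\<forall>J\<subseteq>I. dim {y \<in> W. \<forall>i\<in>J. b i \<bullet> y = 0} = dim W - card J)"

lemma subspace_annihilator:
  "subspace W \<Longrightarrow> subspace {y \<in> W. \<forall>i\<in>J. b i \<bullet> y = 0}"
  by (auto simp: subspace_def inner_add_right)

lemma sign_patterns_insert_iff:
  assumes "i \<notin> I" "T \<subseteq> I"
  shows "insert i T \<in> sign_patterns W b (insert i I) \<longleftrightarrow>
           (\<exists>y\<in>W. 0 < b i \<bullet> y \<and> (\<forall>j\<in>I. 0 < sign_of T j * (b j \<bullet> y)))" (is ?pos)
    and "T \<in> sign_patterns W b (insert i I) \<longleftrightarrow>
           (\<exists>y\<in>W. b i \<bullet> y < 0 \<and> (\<forall>j\<in>I. 0 < sign_of T j * (b j \<bullet> y)))" (is ?neg)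
proof -
  have "sign_of (insert i T) j = sign_of T j" if "j \<in> I" for j
    using that assms by (auto simp: sign_of_def)
  moreover have "sign_of (insert i T) i = 1" "sign_of T i = - 1"
    using assms by (auto simp: sign_of_def)
  ultimately show ?pos ?neg
    using assms unfolding sign_patterns_def by auto
qed

text \<open>A witness lying on the hyperplane \<open>b i \<bullet> y = 0\<close> can be pushed off
  it along \<open>z\<close>, by a step too small to change any sign on \<open>I\<close>.\<close>

lemma sign_patterns_insert_Un:
  assumes "finite I" "i \<notin> I" "subspace W" "z \<in> W" "0 < b i \<bullet> z"
  shows "{T. T \<subseteq> I \<and> insert i T \<in> sign_patterns W b (insert i I)} \<union>
         {T. T \<subseteq> I \<and> T \<in> sign_patterns W b (insert i I)} = sign_patterns W b I"
    (is "?P \<union> ?Q = ?R")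
proof
  show "?P \<union> ?Q \<subseteq> ?R"
    using assms(2) by (auto simp: sign_patterns_insert_iff) (auto simp: sign_patterns_def)
next
  show "?R \<subseteq> ?P \<union> ?Q"
  proof
    fix T assume "T \<in> ?R"
    then obtain y where T: "T \<subseteq> I" and y: "y \<in> W" "\<And>j. j \<in> I \<Longrightarrow> 0 < sign_of T j * (b j \<bullet> y)"
      unfolding sign_patterns_def by blast
    show "T \<in> ?P \<union> ?Q"
    proof (cases "b i \<bullet> y = 0")
      case False
      then have "0 < b i \<bullet> y \<or> b i \<bullet> y < 0" by linarith
      then show ?thesis
        using T y assms(2) by (auto simp: sign_patterns_insert_iff)
    next
      case True
      obtain e where e: "e > 0"
        "\<And>t j. \<lbrakk>\<bar>t\<bar> \<le> e; j \<in> I\<rbrakk> \<Longrightarrow> 0 < sign_of T j * (b j \<bullet> y) + t * (sign_of T j * (b j \<bullet> z))"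
        by (rule finite_positive_perturbation[OF assms(1), of "\<lambda>j. sign_of T j * (b j \<bullet> y)"
            "\<lambda>j. sign_of T j * (b j \<bullet> z)"]) (use y in auto)
      have "y + e *\<^sub>R z \<in> W"
        using assms y by (simp add: subspace_add subspace_scale)
      moreover have "0 < b i \<bullet> (y + e *\<^sub>R z)"
        using True e(1) assms(5) by (simp add: inner_add_right)
      moreover have "0 < sign_of T j * (b j \<bullet> (y + e *\<^sub>R z))" if "j \<in> I" for j
        using e(2)[of e j] e(1) that by (simp add: inner_add_right algebra_simps)
      ultimately show ?thesis
        using T assms(2) by (auto simp: sign_patterns_insert_iff)
    qed
  qed
qed

text \<open>
  \<open>T\<close> extends to \<open>i\<close> with both signs iff it is realised on the hyperplane \<open>b i \<bullet> y = 0\<close>: take a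
  positive combination of the two witnesses in one direction, perturb along \<open>z\<close> in the other.
\<close>

lemma sign_patterns_insert_Int:
  assumes "finite I" "i \<notin> I" "subspace W" "z \<in> W" "0 < b i \<bullet> z"
  shows "{T. T \<subseteq> I \<and> insert i T \<in> sign_patterns W b (insert i I)} \<inter>
         {T. T \<subseteq> I \<and> T \<in> sign_patterns W b (insert i I)} =
         sign_patterns {y \<in> W. b i \<bullet> y = 0} b I"
    (is "?P \<inter> ?Q = ?R")
proof
  show "?P \<inter> ?Q \<subseteq> ?R"
  proof
    fix T assume "T \<in> ?P \<inter> ?Q"
    then obtain u v where T: "T \<subseteq> I"
      and u: "u \<in> W" "0 < b i \<bullet> u" "\<And>j. j \<in> I \<Longrightarrow> 0 < sign_of T j * (b j \<bullet> u)"
      and v: "v \<in> W" "b i \<bullet> v < 0" "\<And>j. j \<in> I \<Longrightarrow> 0 < sign_of T j * (b j \<bullet> v)"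
      using assms(2) by (auto simp: sign_patterns_insert_iff)
    define y where "y = (- (b i \<bullet> v)) *\<^sub>R u + (b i \<bullet> u) *\<^sub>R v"
    have "y \<in> W"
      unfolding y_def using u v assms(3) by (intro subspace_add subspace_scale) auto
    moreover have "b i \<bullet> y = 0"
      by (simp add: y_def inner_add_right inner_diff_right)
    moreover have "0 < sign_of T j * (b j \<bullet> y)" if "j \<in> I" for j
    proof -
      have "sign_of T j * (b j \<bullet> y) =
          (- (b i \<bullet> v)) * (sign_of T j * (b j \<bullet> u)) + (b i \<bullet> u) * (sign_of T j * (b j \<bullet> v))"
        by (simp add: y_def inner_add_right inner_diff_right algebra_simps)
      also have "\<dots> > 0"
        using u(2) u(3)[OF that] v(2) v(3)[OF that]
        by (simp only: add_pos_pos mult_pos_pos neg_0_less_iff_less)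
      finally show ?thesis .
    qed
    ultimately show "T \<in> ?R"
      using T unfolding sign_patterns_def by blast
  qed
next
  show "?R \<subseteq> ?P \<inter> ?Q"
  proof
    fix T assume "T \<in> ?R"
    then obtain y where T: "T \<subseteq> I"
      and y: "y \<in> W" "b i \<bullet> y = 0" "\<And>j. j \<in> I \<Longrightarrow> 0 < sign_of T j * (b j \<bullet> y)"
      unfolding sign_patterns_def by blast
    obtain e where e: "e > 0"
        "\<And>t j. \<lbrakk>\<bar>t\<bar> \<le> e; j \<in> I\<rbrakk> \<Longrightarrow> 0 < sign_of T j * (b j \<bullet> y) + t * (sign_of T j * (b j \<bullet> z))"
      by (rule finite_positive_perturbation[OF assms(1), of "\<lambda>j. sign_of T j * (b j \<bullet> y)"
            "\<lambda>j. sign_of T j * (b j \<bullet> z)"]) (use y in auto)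
    have W: "y + t *\<^sub>R z \<in> W" for t
      using assms y by (simp add: subspace_add subspace_scale)
    have pos: "0 < sign_of T j * (b j \<bullet> (y + t *\<^sub>R z))" if "\<bar>t\<bar> \<le> e" "j \<in> I" for t j
      using e(2)[OF that] by (simp add: inner_add_right algebra_simps)
    have "0 < b i \<bullet> (y + e *\<^sub>R z)" "b i \<bullet> (y + (- e) *\<^sub>R z) < 0"
      using y e(1) assms(5) by (simp_all add: inner_add_right inner_diff_right)
    moreover have "\<bar>e\<bar> \<le> e" "\<bar>- e\<bar> \<le> e"
      using e(1) by auto
    ultimately have "insert i T \<in> sign_patterns W b (insert i I)"
      "T \<in> sign_patterns W b (insert i I)"
      unfolding sign_patterns_insert_iff[OF assms(2) T] using W pos by blast+
    then show "T \<in> ?P \<inter> ?Q"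
      using T by blast
  qed
qed

section \<open>Cover's recursion and its solution\<close>

text \<open>Deletion and restriction: the patterns are classified by their sign at \<open>i\<close>.
  Restricted to \<open>I\<close>, the two classes have as union the patterns on \<open>W\<close> and
  as intersection those on the hyperplane, so inclusion-exclusion gives the sum.\<close>

lemma card_sign_patterns_insert:
  assumes "finite I" "i \<notin> I" "subspace W" "z \<in> W" "0 < b i \<bullet> z"
  shows "card (sign_patterns W b (insert i I)) =
           card (sign_patterns W b I) + card (sign_patterns {y \<in> W. b i \<bullet> y = 0} b I)"
proof -
  let ?S = "sign_patterns W b (insert i I)"
  let ?P = "{T. T \<subseteq> I \<and> insert i T \<in> ?S}" and ?Q = "{T. T \<subseteq> I \<and> T \<in> ?S}"
  have fin: "finite ?P" "finite ?Q"
    using assms(1) by (auto intro: finite_subset[of _ "Pow I"])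
  have inj: "inj_on (insert i) ?P"
    using assms(2) by (auto intro!: inj_onI)
  have split: "?S = insert i ` ?P \<union> ?Q"
  proof (intro equalityI subsetI)
    fix T assume T: "T \<in> ?S"
    then have "T \<subseteq> insert i I" by (simp add: sign_patterns_def)
    show "T \<in> insert i ` ?P \<union> ?Q"
    proof (cases "i \<in> T")
      case True
      then have "T = insert i (T - {i})" by auto
      moreover have "T - {i} \<in> ?P"
        using T True \<open>T \<subseteq> insert i I\<close> by (auto simp: insert_absorb)
      ultimately show ?thesis by blast
    qed (use T \<open>T \<subseteq> insert i I\<close> in auto)
  qed auto
  have "insert i ` ?P \<inter> ?Q = {}"
    using assms(2) by blast
  then have "card (insert i ` ?P \<union> ?Q) = card (insert i ` ?P) + card ?Q"
    using fin by (intro card_Un_disjoint finite_imageI)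
  also have "\<dots> = card (?P \<union> ?Q) + card (?P \<inter> ?Q)"
    by (simp only: card_image[OF inj] card_Un_Int[OF fin])
  finally have "card (insert i ` ?P \<union> ?Q) = card (?P \<union> ?Q) + card (?P \<inter> ?Q)" .
  then show ?thesis
    unfolding split[symmetric] sign_patterns_insert_Un[where b = b, OF assms]
      sign_patterns_insert_Int[where b = b, OF assms] .
qed

text \<open>The number of regions cut out by \<open>M\<close> hyperplanes through the origin in
  general position in dimension \<open>d\<close>. Without hyperplanes the empty pattern counts, even
  for \<open>d = 0\<close>; with at least one, dimension \<open>0\<close> leaves no strict
  sign.\<close>

fun cover_number :: "nat \<Rightarrow> nat \<Rightarrow> nat" where
  "cover_number 0 d = 1"
| "cover_number (Suc M) 0 = 0"
| "cover_number (Suc M) (Suc d) = cover_number M (Suc d) + cover_number M d"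

text \<open>Pascal's rule merges the two sums of the recursion. The factor \<open>2\<close> comes
  from the two sides of a single hyperplane.\<close>

lemma cover_number_Suc: "cover_number (Suc M) d = 2 * (\<Sum>l<d. M choose l)"
proof (induction M arbitrary: d)
  case 0
  show ?case
    by (cases d) (auto simp: sum.lessThan_Suc_shift simp del: sum.lessThan_Suc)
next
  case (Suc M)
  show ?case
  proof (cases d)
    case (Suc d')
    have "cover_number (Suc (Suc M)) d =
        2 * (\<Sum>l<Suc d'. M choose l) + 2 * (\<Sum>l<d'. M choose l)"
      by (subst \<open>d = Suc d'\<close>, subst cover_number.simps(3)) (simp only: Suc.IH)
    also have "\<dots> = 2 * (\<Sum>l<Suc d'. Suc M choose l)"
      by (simp add: sum.lessThan_Suc_shift sum.distrib del: sum.lessThan_Suc)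
    finally show ?thesis by (simp only: \<open>d = Suc d'\<close>)
  qed simp
qed

text \<open>\<open>W\<close> is arbitrary in the induction because restriction replaces it by a
  hyperplane section, of dimension one less.\<close>

theorem card_sign_patterns:
  assumes "finite I" "subspace W" "general_position W b I"
  shows "card (sign_patterns W b I) = cover_number (card I) (dim W)"
  using assms
proof (induction I arbitrary: W rule: finite_induct)
  case empty
  then have "sign_patterns W b {} = {{}}"
    using subspace_0 by (auto simp: sign_patterns_def)
  then show ?case by simp
next
  case (insert i I)
  let ?W' = "{y \<in> W. b i \<bullet> y = 0}"
  have gp: "dim {y \<in> W. \<forall>j\<in>J. b j \<bullet> y = 0} = dim W - card J" if "J \<subseteq> insert i I" for J
    using insert.prems(2) that unfolding general_position_def by blast
  have dim': "dim ?W' = dim W - 1"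
    using gp[of "{i}"] by simp
  have W': "subspace ?W'"
    using subspace_annihilator[OF insert.prems(1), of "{i}" b] by simp
  show ?case
  proof (cases "dim W")
    case 0
    then have "b j \<bullet> y = 0" if "y \<in> W" for j y
      using that by auto
    then have "sign_patterns W b (insert i I) = {}"
      by (auto simp: sign_patterns_def)
    then show ?thesis
      using insert.hyps by (simp add: 0 del: dim_eq_0)
  next
    case (Suc d)
    then have "?W' \<noteq> W" using dim' by auto
    then obtain z where "z \<in> W" "b i \<bullet> z \<noteq> 0" by blast
    then obtain z where z: "z \<in> W" "0 < b i \<bullet> z"
      by (metis inner_minus_right insert.prems(1) linorder_neqE_linordered_idom neg_0_less_iff_less
          subspace_neg)
    \<comment> \<open>Inside \<open>?W'\<close> the annihilator of \<open>J\<close> is that of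
      \<open>insert i J\<close> in \<open>W\<close>, and
      \<open>dim W - Suc (card J) = (dim W - 1) - card J\<close> survives truncation.\<close>
    have "dim {y \<in> ?W'. \<forall>j\<in>J. b j \<bullet> y = 0} = dim ?W' - card J" if "J \<subseteq> I" for J
    proof -
      have "i \<notin> J" "finite J"
        using that insert.hyps by (auto intro: finite_subset)
      then show ?thesis
        using gp[of "insert i J"] that dim' by (auto simp: conj_assoc)
    qed
    then have "general_position ?W' b I"
      unfolding general_position_def by blast
    moreover have "general_position W b I"
      using insert.prems(2) unfolding general_position_def by blast
    ultimately show ?thesis
      using insert Suc dim' W' by (simp add: card_sign_patterns_insert[OF insert.hyps insert.prems(1), of z b] z)
  qed
qed

section \<open>From nonnegative to strictly positive solutions\<close>

text \<open>Let \<open>J\<close> be the set of constraints that are tight at \<open>y\<close>.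
  General position supplies a \<open>z\<close> that is positive on all of \<open>J\<close>; a small
  step from \<open>y\<close> along \<open>z\<close> then makes every constraint strict.\<close>

lemma general_position_positive_iff:
  assumes "finite I" "subspace W" "general_position W b I" "dim W < card I"
  shows "(\<exists>y\<in>W. y \<noteq> 0 \<and> (\<forall>i\<in>I. 0 \<le> b i \<bullet> y)) \<longleftrightarrow> (\<exists>y\<in>W. \<forall>i\<in>I. 0 < b i \<bullet> y)"
proof
  assume "\<exists>y\<in>W. \<forall>i\<in>I. 0 < b i \<bullet> y"
  then obtain y where y: "y \<in> W" "\<forall>i\<in>I. 0 < b i \<bullet> y" by blast
  \<comment> \<open>\<open>dim W < card I\<close> excludes \<open>I = {}\<close>, where
    \<open>y = 0\<close> would be a witness.\<close>
  moreover have "y \<noteq> 0"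
    using y assms(4) by (cases "I = {}") auto
  ultimately show "\<exists>y\<in>W. y \<noteq> 0 \<and> (\<forall>i\<in>I. 0 \<le> b i \<bullet> y)"
    using less_imp_le by blast
next
  assume "\<exists>y\<in>W. y \<noteq> 0 \<and> (\<forall>i\<in>I. 0 \<le> b i \<bullet> y)"
  then obtain y where y: "y \<in> W" "y \<noteq> 0" "\<And>i. i \<in> I \<Longrightarrow> 0 \<le> b i \<bullet> y" by blast
  define J where "J = {i \<in> I. b i \<bullet> y = 0}"
  have J: "J \<subseteq> I" "finite J" using assms(1) by (auto simp: J_def)
  have gp: "dim {y \<in> W. \<forall>j\<in>K. b j \<bullet> y = 0} = dim W - card K" if "K \<subseteq> I" for K
    using assms(3) that unfolding general_position_def by blast
  \<comment> \<open>The annihilator of \<open>J\<close> contains the nonzero vector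
    \<open>y\<close>, so the subtraction \<open>dim W - card J\<close> does not reach
    \<open>0\<close>.\<close>
  have "dim {y \<in> W. \<forall>j\<in>J. b j \<bullet> y = 0} \<noteq> 0"
    using y by (auto simp: J_def)
  then have small: "card J < dim W"
    using gp[OF J(1)] by simp
  \<comment> \<open>Dual vectors for \<open>J\<close>: as \<open>card J < dim W\<close>, dropping
    \<open>i\<close> raises the dimension of the annihilator by exactly one, so some vector killed
    by the rest of \<open>J\<close> is not killed by \<open>b i\<close>.\<close>
  have "\<exists>z\<in>W. (\<forall>j\<in>J - {i}. b j \<bullet> z = 0) \<and> 0 < b i \<bullet> z" if i: "i \<in> J" for i
  proof -
    have "card J = Suc (card (J - {i}))"
      using card_Suc_Diff1[OF J(2) i] by simp
    then have "{y \<in> W. \<forall>j\<in>J - {i}. b j \<bullet> y = 0} \<noteq> {y \<in> W. \<forall>j\<in>J. b j \<bullet> y = 0}"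
      using gp[of J] gp[of "J - {i}"] small J by fastforce
    then obtain z where "z \<in> W" "\<forall>j\<in>J - {i}. b j \<bullet> z = 0" "b i \<bullet> z \<noteq> 0"
      by blast
    moreover from this have "- z \<in> W" using assms(2) by (simp add: subspace_neg)
    ultimately show ?thesis
      by (intro bexI[of _ "if 0 < b i \<bullet> z then z else - z"]) auto
  qed
  then obtain f where f: "\<And>i. i \<in> J \<Longrightarrow> f i \<in> W"
    "\<And>i j. \<lbrakk>i \<in> J; j \<in> J - {i}\<rbrakk> \<Longrightarrow> b j \<bullet> f i = 0" "\<And>i. i \<in> J \<Longrightarrow> 0 < b i \<bullet> f i"
    by metis
  define z where "z = (\<Sum>i\<in>J. f i)"
  have zW: "z \<in> W"
    unfolding z_def using f assms(2) by (intro subspace_sum)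
  have zpos: "0 < b j \<bullet> z" if "j \<in> J" for j
  proof -
    have "b j \<bullet> z = b j \<bullet> f j + (\<Sum>i\<in>J - {j}. b j \<bullet> f i)"
      unfolding z_def inner_sum_right using J(2) that by (simp add: sum.remove)
    also have "(\<Sum>i\<in>J - {j}. b j \<bullet> f i) = 0"
      using f that by (intro sum.neutral) auto
    finally show ?thesis using f that by simp
  qed
  obtain e where e: "e > 0"
    "\<And>t j. \<lbrakk>\<bar>t\<bar> \<le> e; j \<in> I - J\<rbrakk> \<Longrightarrow> 0 < b j \<bullet> y + t * (b j \<bullet> z)"
  proof (rule finite_positive_perturbation[of "I - J" "\<lambda>j. b j \<bullet> y" "\<lambda>j. b j \<bullet> z"])
    show "0 < b j \<bullet> y" if "j \<in> I - J" for j
      using y(3)[of j] that by (auto simp: J_def less_le)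
  qed (use assms(1) in auto)
  have "0 < b j \<bullet> (y + e *\<^sub>R z)" if "j \<in> I" for j
  proof (cases "j \<in> J")
    case True
    then show ?thesis
      using zpos[of j] e(1) by (simp add: inner_add_right J_def)
  next
    case False
    then show ?thesis
      using e(2)[of e j] e(1) that by (simp add: inner_add_right)
  qed
  moreover have "y + e *\<^sub>R z \<in> W"
    using y zW assms(2) by (simp add: subspace_add subspace_scale)
  ultimately show "\<exists>y\<in>W. \<forall>i\<in>I. 0 < b i \<bullet> y" by blast
qed

section \<open>Linear algebra of columns, row spans and feasible cones\<close>

text \<open>A \<open>J\<close> of at most \<open>DIM('v)\<close> indices extends within
  \<open>I\<close> to an independent family of full size, so its annihilator is an orthogonal
  complement of the expected dimension. A larger \<open>J\<close> contains a full family, whose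
  annihilator is already trivial.\<close>

lemma general_position_UNIV:
  fixes b :: "'i \<Rightarrow> 'v::euclidean_space"
  assumes "DIM('v) \<le> card I"
    and indep: "\<And>J. \<lbrakk>J \<subseteq> I; card J = DIM('v)\<rbrakk> \<Longrightarrow> inj_on b J \<and> independent (b ` J)"
  shows "general_position UNIV b I"
  unfolding general_position_def
proof (intro allI impI)
  fix J assume J: "J \<subseteq> I"
  have "finite I"
    using assms(1) DIM_positive[where 'a='v] card_ge_0_finite by force
  have small: "dim {y. \<forall>i\<in>J. b i \<bullet> y = 0} = DIM('v) - card J"
    if J: "J \<subseteq> I" "card J \<le> DIM('v)" for J
  proof -
    obtain K where K: "J \<subseteq> K" "K \<subseteq> I" "card K = DIM('v)"
      using exists_subset_between[OF J(2) assms(1) J(1) \<open>finite I\<close>] by blast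
    then have "inj_on b K" "independent (b ` K)"
      using indep[of K] by auto
    then have "inj_on b J" "independent (b ` J)"
      using inj_on_subset[of b K J] independent_mono[of "b ` K" "b ` J"] K(1) by auto
    then have "dim (span (b ` J)) = card J"
      by (simp add: dim_eq_card_independent card_image)
    moreover have "{y. \<forall>i\<in>J. b i \<bullet> y = 0} = {y \<in> UNIV. \<forall>x \<in> span (b ` J). orthogonal x y}"
    proof -
      have "orthogonal y x" if "\<forall>i\<in>J. b i \<bullet> y = 0" "x \<in> span (b ` J)" for x y
        by (rule orthogonal_to_span[OF that(2)])
          (use that(1) in \<open>auto simp: orthogonal_def inner_commute\<close>)
      moreover have "b i \<bullet> y = 0" if "i \<in> J" "\<forall>x\<in>span (b ` J). orthogonal x y" for i y
        using that span_base[of "b i" "b ` J"] by (auto simp: orthogonal_def)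
      ultimately show ?thesis
        by (auto simp: orthogonal_commute)
    qed
    ultimately show ?thesis
      using dim_subspace_orthogonal_to_vectors[of "span (b ` J)" UNIV] by simp
  qed
  show "dim {y \<in> UNIV. \<forall>i\<in>J. b i \<bullet> y = 0} = dim (UNIV :: 'v set) - card J"
  proof (cases "card J \<le> DIM('v)")
    case True
    then show ?thesis using small[OF J] by simp
  next
    case False
    then obtain K where K: "K \<subseteq> J" "card K = DIM('v)"
      by (meson nat_le_linear obtain_subset_with_card_n)
    then have "dim {y. \<forall>i\<in>K. b i \<bullet> y = 0} = 0"
      using small[of K] J by simp
    moreover have "dim {y. \<forall>i\<in>J. b i \<bullet> y = 0} \<le> dim {y. \<forall>i\<in>K. b i \<bullet> y = 0}"
      using K by (intro dim_subset) auto
    ultimately show ?thesis using False by (simp del: dim_eq_0)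
  qed
qed

text \<open>The entries of \<open>y\<close> are the coefficients of a combination of rows. The
  coordinates of a vector in the row span thus become the inner products whose signs are
  counted.\<close>

lemma row_span_eq:
  fixes B :: "real ^ 'N ^ 'm"
  shows "row_span B = range (\<lambda>y. \<chi> i. column i B \<bullet> y)"
proof
  have "linear (\<lambda>y. \<chi> i. column i B \<bullet> y)"
    by (rule linearI) (simp_all add: vec_eq_iff inner_add_right)
  then have "subspace (range (\<lambda>y. \<chi> i. column i B \<bullet> y))"
    by (rule linear_subspace_image) (rule subspace_UNIV)
  moreover have "row j B = (\<chi> i. column i B \<bullet> axis j 1)" for j
    by (simp add: vec_eq_iff row_def column_def inner_axis)
  ultimately show "row_span B \<subseteq> range (\<lambda>y. \<chi> i. column i B \<bullet> y)"
    unfolding row_span_def by (intro span_minimal) (auto simp: rows_def)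
next
  have "(\<chi> i. column i B \<bullet> y) = transpose B *v y" for y
    by (simp add: vec_eq_iff matrix_vector_mult_def transpose_def column_def inner_vec_def)
  then show "range (\<lambda>y. \<chi> i. column i B \<bullet> y) \<subseteq> row_span B"
    using matrix_vector_mult_in_columnspace[of "transpose B"]
    by (auto simp: row_span_def columns_transpose)
qed

text \<open>Positive coordinates of \<open>x0\<close> stay positive for small \<open>t\<close>, so
  only its zero coordinates constrain the direction.\<close>

lemma Feas_nonneg_orthant:
  fixes x0 :: "real ^ 'N"
  assumes "x0 \<in> nonneg_orthant"
  shows "Feas x0 nonneg_orthant = {v. \<forall>i. x0 $ i = 0 \<longrightarrow> 0 \<le> v $ i}"
proof (intro equalityI subsetI)
  fix v :: "real ^ 'N" assume "v \<in> Feas x0 nonneg_orthant"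
  then obtain \<epsilon> where "\<epsilon> > 0" "\<And>t. \<lbrakk>0 < t; t < \<epsilon>\<rbrakk> \<Longrightarrow> x0 + t *\<^sub>R v \<in> nonneg_orthant"
    unfolding Feas_def by blast
  from \<open>\<epsilon> > 0\<close> this(2)[of "\<epsilon> / 2"] have nn: "0 \<le> x0 $ i + \<epsilon> / 2 * v $ i" for i
    by (simp add: nonneg_orthant_def)
  have "0 \<le> v $ i" if "x0 $ i = 0" for i
    using nn[of i] that \<open>\<epsilon> > 0\<close> by (simp add: zero_le_mult_iff)
  then show "v \<in> {v. \<forall>i. x0 $ i = 0 \<longrightarrow> 0 \<le> v $ i}"
    by blast
next
  fix v :: "real ^ 'N" assume v: "v \<in> {v. \<forall>i. x0 $ i = 0 \<longrightarrow> 0 \<le> v $ i}"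
  have "0 < x0 $ i" if "i \<in> {i. x0 $ i \<noteq> 0}" for i
    using assms that by (simp add: nonneg_orthant_def less_le)
  then obtain e where e: "e > 0"
    "\<And>t i. \<lbrakk>\<bar>t\<bar> \<le> e; i \<in> {i. x0 $ i \<noteq> 0}\<rbrakk> \<Longrightarrow> 0 < x0 $ i + t * v $ i"
    by (rule finite_positive_perturbation[of "{i. x0 $ i \<noteq> 0}" "\<lambda>i. x0 $ i" "\<lambda>i. v $ i", rotated]) auto
  have "x0 + t *\<^sub>R v \<in> nonneg_orthant" if t: "0 < t" "t < e" for t
    unfolding nonneg_orthant_def
  proof (intro CollectI allI)
    fix i
    show "0 \<le> (x0 + t *\<^sub>R v) $ i"
      using v t e(2)[of t i] by (cases "x0 $ i = 0") auto
  qed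
  then show "v \<in> Feas x0 nonneg_orthant"
    unfolding Feas_def using e(1) by blast
qed

section \<open>Measurability, and the probability of a sign pattern\<close>

text \<open>After scaling, a nonzero kernel vector in \<open>C\<close> may be sought on the unit
  sphere. The matrices having one form the projection of a closed set along a compact factor, hence
  a closed set, and the complement is open.\<close>

lemma sets_nullspace_Int_cone:
  fixes C :: "(real ^ 'N) set"
  assumes "closed C" "cone C" "0 \<in> C"
  shows "{A :: real ^ 'N ^ 'n. nullspace A \<inter> C = {0}} \<in> sets borel"
proof -
  let ?K = "C \<inter> sphere 0 1"
  have "nullspace A \<inter> C = {0} \<longleftrightarrow> \<not> (\<exists>v. v \<in> ?K \<and> A *v v = 0)" for A :: "real ^ 'N ^ 'n"
  proof -
    have "\<exists>v. v \<in> ?K \<and> A *v v = 0" if v: "v \<in> C" "A *v v = 0" "v \<noteq> 0" for v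
    proof (intro exI conjI IntI)
      show "(1 / norm v) *\<^sub>R v \<in> C"
        using v(1) assms(2) by (simp add: mem_cone)
      show "A *v ((1 / norm v) *\<^sub>R v) = 0"
        using v(2) by (simp add: matrix_vector_mult_scaleR)
    qed (use v(3) in simp)
    moreover have "v \<noteq> 0" if "v \<in> ?K" for v
      using that by auto
    moreover have "nullspace A \<inter> C = {0} \<longleftrightarrow> (\<forall>v\<in>C. A *v v = 0 \<longrightarrow> v = 0)"
      using assms(3) by (auto simp: nullspace_def)
    ultimately show ?thesis by blast
  qed
  moreover
  have "closed {A :: real ^ 'N ^ 'n. \<exists>v. v \<in> ?K \<and> (v, A) \<in> {p. snd p *v fst p = 0}}"
  proof (rule closed_compact_projection)
    show "compact ?K"
      using assms(1) by (simp add: closed_Int_compact)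
    have "continuous_on UNIV (\<lambda>p :: (real ^ 'N) \<times> (real ^ 'N ^ 'n). snd p *v fst p)"
      unfolding matrix_vector_mult_def by (intro continuous_intros)
    then show "closed {p :: (real ^ 'N) \<times> (real ^ 'N ^ 'n). snd p *v fst p = 0}"
      by (rule closed_Collect_eq) (rule continuous_on_const)
  qed
  then have "open {A :: real ^ 'N ^ 'n. \<not> (\<exists>v. v \<in> ?K \<and> A *v v = 0)}"
    unfolding open_closed Collect_neg_eq double_complement by simp
  ultimately show ?thesis
    by (simp only: borel_open)
qed

definition sign_diag :: "'N set \<Rightarrow> real ^ 'N ^ 'N" where
  "sign_diag T = (\<chi> i j. if i = j then sign_of T i else 0)"

lemma sign_matrix_sign_diag: "sign_matrix (sign_diag T)"
  by (auto simp: sign_matrix_def sign_diag_def sign_of_def)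

lemma column_mult_sign_diag: "column i (B ** sign_diag T) = sign_of T i *\<^sub>R column i B"
  by (simp add: vec_eq_iff column_def matrix_matrix_mult_def sign_diag_def if_distrib
      mult.commute cong: if_cong)

text \<open>The union over \<open>y\<close> is uncountable, but it is a union of open sets and so is
  Borel.\<close>

lemma sets_sign_patterns:
  "{B :: real ^ 'N ^ 'm. T \<in> sign_patterns UNIV (\<lambda>i. column i B) I} \<in> sets borel"
proof (cases "T \<subseteq> I")
  case True
  have "open {B :: real ^ 'N ^ 'm. 0 < sign_of T i * (column i B \<bullet> y)}" for i y
    unfolding column_def inner_vec_def
    by (intro open_Collect_less continuous_intros)
  then have "open (\<Union>y. \<Inter>i\<in>I. {B :: real ^ 'N ^ 'm. 0 < sign_of T i * (column i B \<bullet> y)})"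
    by (intro open_UN ballI open_INT) auto
  also have "(\<Union>y. \<Inter>i\<in>I. {B :: real ^ 'N ^ 'm. 0 < sign_of T i * (column i B \<bullet> y)}) =
      {B. T \<in> sign_patterns UNIV (\<lambda>i. column i B) I}"
    using True by (auto simp: sign_patterns_def)
  finally show ?thesis by simp
qed (simp add: sign_patterns_def)

text \<open>There are only finitely many \<open>J\<close>, so their exceptional null sets combine
  into one.\<close>

lemma generic_columns_general_position:
  fixes B :: "'a \<Rightarrow> real ^ 'N ^ 'm" and I :: "'N set"
  assumes "generic_columns M B" "CARD('m) \<le> card I"
  shows "AE \<omega> in M. general_position UNIV (\<lambda>i. column i (B \<omega>)) I"
proof -
  have "AE \<omega> in M. \<forall>J\<in>{J :: 'N set. card J = CARD('m)}.
      inj_on (\<lambda>j. column j (B \<omega>)) J \<and> independent ((\<lambda>j. column j (B \<omega>)) ` J)"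
    using assms(1) by (intro AE_finite_allI) (auto simp: generic_columns_def)
  then show ?thesis
    by eventually_elim (use assms(2) in \<open>auto intro!: general_position_UNIV\<close>)
qed

text \<open>Multiplying by \<open>sign_diag T\<close> flips the columns outside \<open>T\<close>,
  which carries the pattern \<open>T\<close> to the all-positive pattern \<open>I\<close>.\<close>

lemma (in prob_space) prob_sign_patterns_eq:
  fixes B :: "'a \<Rightarrow> real ^ 'N ^ 'm"
  assumes "orthant_symmetric M B" "T \<subseteq> I"
  shows "\<P>(\<omega> in M. T \<in> sign_patterns UNIV (\<lambda>i. column i (B \<omega>)) I) =
         \<P>(\<omega> in M. I \<in> sign_patterns UNIV (\<lambda>i. column i (B \<omega>)) I)"
proof -
  have "T \<in> sign_patterns UNIV (\<lambda>i. column i X) I \<longleftrightarrow>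
      X ** sign_diag T \<in> {X. I \<in> sign_patterns UNIV (\<lambda>i. column i X) I}" for X :: "real ^ 'N ^ 'm"
    using assms(2) by (simp add: sign_patterns_def column_mult_sign_diag) (simp add: sign_of_def)
  then show ?thesis
    using assms(1) sets_sign_patterns[of I I, where 'm = 'm] sign_matrix_sign_diag[of T]
    unfolding orthant_symmetric_def by fastforce
qed

text \<open>The \<open>2 ^ card I\<close> equal probabilities add up to the expected number of
  realised patterns, and that number is almost surely the Cover count.\<close>

theorem (in prob_space) wendel:
  fixes B :: "'a \<Rightarrow> real ^ 'N ^ 'm" and I :: "'N set"
  assumes B[measurable]: "B \<in> borel_measurable M"
    and sym: "orthant_symmetric M B" and gen: "generic_columns M B" and "CARD('m) \<le> card I"
  shows "\<P>(\<omega> in M. I \<in> sign_patterns UNIV (\<lambda>i. column i (B \<omega>)) I) =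
           cover_number (card I) CARD('m) / 2 ^ card I"
proof -
  define S where "S \<omega> = sign_patterns UNIV (\<lambda>i. column i (B \<omega>)) I" for \<omega>
  define E where "E T = {\<omega> \<in> space M. T \<in> S \<omega>}" for T
  have E[measurable]: "E T \<in> events" for T
    using measurable_sets[OF B sets_sign_patterns[of T I]]
    by (simp add: E_def S_def vimage_def Int_def conj_commute)
  have "2 ^ card I * prob (E I) = (\<Sum>T\<in>Pow I. prob (E I))"
    by (simp add: card_Pow)
  also have "\<dots> = (\<Sum>T\<in>Pow I. prob (E T))"
    unfolding E_def S_def
    by (intro sum.cong refl prob_sign_patterns_eq[OF sym, symmetric]) (rule PowD)
  also have "\<dots> = (\<integral>\<omega>. (\<Sum>T\<in>Pow I. indicator (E T) \<omega>) \<partial>M)"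
    by (subst Bochner_Integration.integral_sum) (auto intro!: integrable_real_indicator simp: emeasure_eq_measure)
  also have "\<dots> = (\<integral>\<omega>. real (cover_number (card I) CARD('m)) \<partial>M)"
  proof (rule integral_cong_AE)
    show "AE \<omega> in M. (\<Sum>T\<in>Pow I. indicator (E T) \<omega>) = real (cover_number (card I) CARD('m))"
      using generic_columns_general_position[OF gen assms(4)] AE_space
    proof eventually_elim
      case (elim \<omega>)
      have "S \<omega> \<subseteq> Pow I"
        by (auto simp: S_def sign_patterns_def)
      then have "(\<Sum>T\<in>Pow I. indicator (E T) \<omega>) = (\<Sum>T\<in>S \<omega>. 1 :: real)"
        using elim(2) by (intro sum.mono_neutral_cong_right) (auto simp: E_def)
      also have "\<dots> = card (S \<omega>)"
        by simp
      also have "\<dots> = cover_number (card I) CARD('m)"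
        unfolding S_def using card_sign_patterns[OF _ subspace_UNIV elim(1)] by simp
      finally show ?case by simp
    qed
  qed auto
  also have "\<dots> = cover_number (card I) CARD('m)"
    by (simp add: prob_space)
  finally have "prob (E I) = cover_number (card I) CARD('m) / 2 ^ card I"
    by (simp add: nonzero_eq_divide_eq mult.commute)
  then show ?thesis
    unfolding E_def S_def .
qed

section \<open>The nullspace against the feasible cone\<close>

text \<open>The factor \<open>2\<close> of the closed form turns \<open>1 / 2 ^ M\<close> into the
  power in \<open>P_coeff\<close>. Positivity of \<open>m\<close> matters: at \<open>m = 0\<close>
  the truncated range \<open>{0..m - 1}\<close> would still contain \<open>0\<close>.\<close>

lemma P_coeff_eq_cover_number:
  assumes "0 < m" "0 < M"
  shows "P_coeff m M = cover_number M m / 2 ^ M"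
proof -
  obtain M' where M: "M = Suc M'" using assms(2) gr0_implies_Suc by blast
  have "{0..m - 1} = {..<m}" using assms(1) by auto
  moreover have "(2 :: real) powi (- int M + 1) = 2 / 2 ^ M"
    by (simp add: M power_int_minus field_simps)
  ultimately show ?thesis
    unfolding P_coeff_def M cover_number_Suc by (simp add: M)
qed

lemma row_span_Int_cone_iff:
  fixes B :: "real ^ 'N ^ 'm" and I :: "'N set"
  assumes gp: "general_position UNIV (\<lambda>i. column i B) I" and card: "CARD('m) < card I"
  shows "row_span B \<inter> {v. \<forall>i\<in>I. 0 \<le> v $ i} = {0} \<longleftrightarrow>
           I \<notin> sign_patterns UNIV (\<lambda>i. column i B) I"
proof -
  \<comment> \<open>More than \<open>CARD('m)\<close> columns in general position have trivial
    annihilator, so a nonzero \<open>y\<close> yields a nonzero vector of the row span.\<close>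
  have ker: "y = 0" if "\<And>i. i \<in> I \<Longrightarrow> column i B \<bullet> y = 0" for y
  proof -
    have "dim {y. \<forall>i\<in>I. column i B \<bullet> y = 0} = 0"
      using gp card unfolding general_position_def by (auto dest!: spec[of _ I] simp del: dim_eq_0)
    then show ?thesis using that by auto
  qed
  have "row_span B \<inter> {v. \<forall>i\<in>I. 0 \<le> v $ i} = {0} \<longleftrightarrow>
      \<not> (\<exists>y\<in>UNIV. y \<noteq> 0 \<and> (\<forall>i\<in>I. 0 \<le> column i B \<bullet> y))" (is "?L \<longleftrightarrow> ?R")
  proof
    assume L: ?L
    show ?R
    proof
      assume "\<exists>y\<in>UNIV. y \<noteq> 0 \<and> (\<forall>i\<in>I. 0 \<le> column i B \<bullet> y)"
      then obtain y where y: "y \<noteq> 0" "\<forall>i\<in>I. 0 \<le> column i B \<bullet> y" by blast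
      then have "(\<chi> i. column i B \<bullet> y) \<in> row_span B \<inter> {v. \<forall>i\<in>I. 0 \<le> v $ i}"
        by (simp add: row_span_eq)
      then have "column i B \<bullet> y = 0" for i
        unfolding L by (simp add: vec_eq_iff)
      then show False using ker y(1) by blast
    qed
  next
    assume R: ?R
    have "0 \<in> row_span B" by (simp add: row_span_def span_zero)
    moreover have "v = 0" if v: "v \<in> row_span B" "\<forall>i\<in>I. 0 \<le> v $ i" for v
    proof -
      obtain y where y: "v = (\<chi> i. column i B \<bullet> y)"
        using v(1) unfolding row_span_eq by blast
      then have "y = 0"
        using R v(2) by auto
      with y have "v = (\<chi> i. column i B \<bullet> 0)"
        by simp
      then show ?thesis
        by (simp add: vec_eq_iff)
    qed
    ultimately show ?L by auto
  qed
  also have "\<dots> \<longleftrightarrow> \<not> (\<exists>y\<in>UNIV. \<forall>i\<in>I. 0 < column i B \<bullet> y)"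
    using general_position_positive_iff[OF _ subspace_UNIV gp] card by simp
  also have "\<dots> \<longleftrightarrow> I \<notin> sign_patterns UNIV (\<lambda>i. column i B) I"
    by (simp add: sign_patterns_def sign_of_def)
  finally show ?thesis .
qed

theorem lemma2p3:
  fixes M :: "'a measure"
    and A :: "'a \<Rightarrow> real ^ 'N ^ 'n"
    and x0 :: "real ^ 'N"
    and k :: nat
  assumes "prob_space M"
    and "A \<in> borel_measurable M"
    and "k < CARD('n)"
    and "CARD('n) < CARD('N)"
    and "CARD('m::finite) = CARD('N) - CARD('n)"
    and "x0 \<in> nonneg_orthant"
    and "card {i. x0 $ i \<noteq> 0} = k"
    and "exchangeable_columns M A"
    and "orthant_symmetric_generic_nullspace TYPE('m) M A"
  shows "\<P>(\<omega> in M. nullspace (A \<omega>) \<inter> Feas x0 nonneg_orthant = {0})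
           = 1 - P_coeff (CARD('N) - CARD('n)) (CARD('N) - k)"
proof -
  interpret prob_space M by fact
  obtain B :: "'a \<Rightarrow> real ^ 'N ^ 'm" where B: "B \<in> borel_measurable M"
    and sym: "orthant_symmetric M B" and gen: "generic_columns M B"
    and null: "AE \<omega> in M. nullspace (A \<omega>) = row_span (B \<omega>)"
    using assms(9) unfolding orthant_symmetric_generic_nullspace_def by blast
  define I where "I = {i. x0 $ i = 0}"
  define C where "C = {v :: real ^ 'N. \<forall>i\<in>I. 0 \<le> v $ i}"
  have "I = - {i. x0 $ i \<noteq> 0}" by (auto simp: I_def)
  then have cardI: "card I = CARD('N) - k"
    using assms(7) by (simp add: Compl_eq_Diff_UNIV card_Diff_subset)
  \<comment> \<open>This is where \<open>k < n\<close> enters: it gives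
    \<open>N - n < N - k\<close>.\<close>
  then have card: "CARD('m) < card I"
    using assms(3,4,5) by linarith
  have Feas: "Feas x0 nonneg_orthant = C"
    using Feas_nonneg_orthant[OF assms(6)] by (auto simp: C_def I_def)
  let ?S = "\<lambda>\<omega>. sign_patterns UNIV (\<lambda>i. column i (B \<omega>)) I"
  have SB: "{\<omega> \<in> space M. I \<in> ?S \<omega>} \<in> events"
    using measurable_sets[OF B sets_sign_patterns[of I I]]
    by (simp add: vimage_def Int_def conj_commute)
  have "C = (\<Inter>i\<in>I. {v. 0 \<le> v $ i})" by (auto simp: C_def)
  moreover have "closed {v :: real ^ 'N. 0 \<le> v $ i}" for i
    by (intro closed_Collect_le continuous_intros)
  ultimately have "closed C" by auto
  moreover have "cone C" "0 \<in> C" by (auto simp: C_def cone_def)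
  ultimately have "{\<omega> \<in> space M. nullspace (A \<omega>) \<inter> C = {0}} \<in> events"
    using measurable_sets[OF assms(2) sets_nullspace_Int_cone[of C]]
    by (simp add: vimage_def Int_def conj_commute)
  \<comment> \<open>The two events agree only almost surely, so comparing their probabilities
    requires each to be measurable in its own right.\<close>
  moreover have "AE \<omega> in M. nullspace (A \<omega>) \<inter> C = {0} \<longleftrightarrow> I \<notin> ?S \<omega>"
    using null generic_columns_general_position[OF gen less_imp_le[OF card]]
    by eventually_elim (simp add: C_def row_span_Int_cone_iff[OF _ card])
  ultimately have "\<P>(\<omega> in M. nullspace (A \<omega>) \<inter> C = {0}) = \<P>(\<omega> in M. I \<notin> ?S \<omega>)"
    using SB by (intro finite_measure_eq_AE) auto
  also have "\<dots> = 1 - \<P>(\<omega> in M. I \<in> ?S \<omega>)"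
    using prob_compl[OF SB] by (auto simp: set_diff_eq cong: conj_cong)
  also have "\<dots> = 1 - P_coeff (CARD('N) - CARD('n)) (CARD('N) - k)"
  proof -
    have "P_coeff CARD('m) (card I) = cover_number (card I) CARD('m) / 2 ^ card I"
      using card by (intro P_coeff_eq_cover_number) auto
    then show ?thesis
      by (simp only: wendel[OF B sym gen less_imp_le[OF card]] flip: cardI assms(5))
  qed
  finally show ?thesis unfolding Feas .
qed

end
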